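(* Let $n,r$ be positive integers with $n\ge r$, and let $k_1,\dots,k_r$ be integers. Then $$\sum_{m=r}^n {m \brace k_1,k_2,\cdots,k_r} S_1(n,m) = \sum_{m=r}^n \frac{n!}{m!}L^{(k_1,k_2,\cdots,k_r)}(m,r) \binom{r}{n-m}(-1)^{n-m},$$ where ${m \brace k_1,\cdots,k_r}$ is the multi-Stirling number of the second kind, $S_1(n,m)$ is the (signed) Stirling number of the first kind, and $L^{(k_1,\cdots,k_r)}(m,r)$ is the multi-Lah number.
   Context: For integers $k_1,\dots,k_r$ the multiple logarithm of index $(k_1,\dots,k_r)$ is the power series $$\mathrm{Li}_{k_1,k_2,\cdots,k_r}(t)=\sum_{0<m_1<m_2<\cdots<m_r}\frac{t^{m_r}}{m_1^{k_1}m_2^{k_2}\cdots m_r^{k_r}},$$ the sum being over integers $m_1,\dots,m_r$. The multi-Stirling numbers of the second kind ${n \brace k_1,k_2,\cdots,k_r}$ are defined by the generating function (as a power series in $t$) $$\mathrm{Li}_{k_1,k_2,\cdots,k_r}(1-e^{1-e^t})=\sum_{n=r}^\infty {n \brace k_1,k_2,\cdots,k_r}\frac{t^n}{n!}.$$ The multi-Lah numbers $L^{(k_1,k_2,\cdots,k_r)}(n,r)$ are defined by $$\frac{\mathrm{Li}_{k_1,\cdots,k_r}(1-e^{-t})}{(1-t)^r}=\sum_{n=r}^\infty L^{(k_1,k_2,\cdots,k_r)}(n,r)\frac{t^n}{n!}.$$ The signed Stirling numbers of the first kind $S_1(n,k)$ are defined by $(x)_n=\sum_{k=0}^n S_1(n,k)x^k$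 for $n\ge0$, where $(x)_0=1$ and $(x)_n=x(x-1)\cdots(x-n+1)$ for $n\ge1$. The binomial coefficient $\binom{r}{j}$ is $0$ when $j>r$. *)

theory Defs
  imports
    Complex_Main
    "HOL-Computational_Algebra.Polynomial"
    "HOL-Computational_Algebra.Formal_Power_Series"
begin

(* The index tuples 0 < m_1 < ... < m_r with m_r = N; r = 0 admits only the
   empty tuple, for N = 0. *)
definition mlog_tuples :: "nat \<Rightarrow> nat \<Rightarrow> nat list set" where
  "mlog_tuples r N = {ms. length ms = r \<and> sorted_wrt (<) (0 # ms) \<and> last (0 # ms) = N}"

(* The multiple logarithm as a formal power series: the terms of the defining
   multiple sum are collected by the exponent m_r of t. *)
definition multi_log :: "int list \<Rightarrow> real fps" where
  "multi_log ks = Abs_fps (\<lambda>N. \<Sum>ms\<in>mlog_tuples (length ks) N.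
     1 / (\<Prod>i<length ks. real (ms ! i) powi (ks ! i)))"

(* n! times the coefficient of t^n in Li(1 - e^(1 - e^t)). *)
definition multi_stirling2 :: "nat \<Rightarrow> int list \<Rightarrow> real" where
  "multi_stirling2 n ks =
     fact n * fps_nth (multi_log ks oo (1 - (fps_exp 1 oo (1 - fps_exp 1)))) n"

(* n! times the coefficient of t^n in Li(1 - e^(-t)) / (1 - t)^r, where r is the
   length of the index. *)
definition multi_lah :: "int list \<Rightarrow> nat \<Rightarrow> real" where
  "multi_lah ks n =
     fact n * fps_nth ((multi_log ks oo (1 - fps_exp (- 1))) / (1 - fps_X) ^ length ks) n"

(* The coefficients of the falling factorial x (x - 1) ... (x - n + 1). *)
definition signed_stirling1 :: "nat \<Rightarrow> nat \<Rightarrow> int" where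
  "signed_stirling1 n k = coeff (\<Prod>i<n. [:- int i, 1:]) k"

lemma sorted_wrt_less_last_ge:
  fixes a :: nat
  assumes "sorted_wrt (<) (a # ms)"
  shows "a + length ms \<le> last (a # ms)"
  using assms
proof (induction ms arbitrary: a)
  case (Cons b ms)
  then have "b + length ms \<le> last (b # ms)" "a < b" by auto
  then show ?case by simp
qed simp

lemma finite_mlog_tuples: "finite (mlog_tuples r N)"
proof (rule finite_subset)
  show "mlog_tuples r N \<subseteq> {ms. set ms \<subseteq> {..N} \<and> length ms = r}"
  proof
    fix ms assume ms: "ms \<in> mlog_tuples r N"
    then have s: "sorted (0 # ms)" and l: "last (0 # ms) = N" and len: "length ms = r"
      by (auto simp: mlog_tuples_def strict_sorted_iff)
    have "x \<le> N" if "x \<in> set ms" for x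
    proof -
      from that obtain i where i: "i < length ms" "ms ! i = x"
        by (auto simp: in_set_conv_nth)
      then have "ms \<noteq> []" by auto
      with i s l show ?thesis
        using sorted_nth_mono[of ms i "length ms - 1"] by (auto simp: last_conv_nth)
    qed
    with len show "ms \<in> {ms. set ms \<subseteq> {..N} \<and> length ms = r}" by auto
  qed
qed (rule finite_lists_length_eq, simp)

lemma multi_log_nth_less:
  assumes "n < length ks"
  shows "fps_nth (multi_log ks) n = 0"
proof -
  have "mlog_tuples (length ks) n = {}"
    using assms sorted_wrt_less_last_ge[of 0] by (fastforce simp: mlog_tuples_def)
  then show ?thesis by (simp add: multi_log_def)
qed

(* Both generating functions start at t^r. *)
lemma multi_stirling2_less: "n < length ks \<Longrightarrow> multi_stirling2 n ks = 0"
  by (simp add: multi_stirling2_def fps_compose_nth multi_log_nth_less)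

lemma multi_lah_less:
  assumes "n < length ks"
  shows "multi_lah ks n = 0"
proof -
  have "fps_nth ((1 - fps_X :: real fps) ^ length ks) 0 \<noteq> 0"
    by (simp add: fps_nth_power_0)
  then show ?thesis
    using assms
    by (simp add: multi_lah_def fps_divide_unit fps_mult_nth fps_compose_nth multi_log_nth_less)
qed

lemma multi_log_single: "n > 0 \<Longrightarrow> fps_nth (multi_log [k]) n = 1 / real n powi k"
proof -
  assume "n > 0"
  then have "mlog_tuples (Suc 0) n = {[n]}"
    by (auto simp: mlog_tuples_def length_Suc_conv)
  then show ?thesis by (simp add: multi_log_def)
qed

lemma falling_factorial_signed_stirling1:
  "(\<Prod>i<n. x - of_nat i) = (\<Sum>k\<le>n. of_int (signed_stirling1 n k) * x ^ k)"
  for x :: "'a :: comm_ring_1"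
proof (induction n)
  case 0
  show ?case by (simp add: signed_stirling1_def)
next
  case (Suc n)
  have deg: "signed_stirling1 n k = 0" if "k > n" for k
  proof -
    have "degree (\<Prod>i<n. [:- int i, 1:]) \<le> (\<Sum>i<n. degree [:- int i, 1:])"
      using degree_prod_sum_le[of "{..<n}" "\<lambda>i. [:- int i, 1:]"] by (simp add: o_def)
    then show ?thesis using that by (simp add: signed_stirling1_def coeff_eq_0)
  qed
  have rec0: "signed_stirling1 (Suc n) 0 = - int n * signed_stirling1 n 0"
    by (simp add: signed_stirling1_def coeff_mult)
  have rec: "signed_stirling1 (Suc n) (Suc k) =
      signed_stirling1 n k - int n * signed_stirling1 n (Suc k)" for k
    by (simp add: signed_stirling1_def mult.commute[of _ "[:- int n, 1:]"])
  have "(\<Sum>k\<le>Suc n. of_int (signed_stirling1 (Suc n) k) * x ^ k)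
      = (\<Sum>k\<le>n. of_int (signed_stirling1 n k) * x ^ Suc k)
        - of_nat n * (\<Sum>k\<le>Suc n. of_int (signed_stirling1 n k) * x ^ k)"
    unfolding sum.atMost_Suc_shift
    by (simp add: rec0 rec algebra_simps sum_subtractf sum_distrib_left)
  also have "\<dots> = (x - of_nat n) * (\<Sum>k\<le>n. of_int (signed_stirling1 n k) * x ^ k)"
    by (simp add: deg left_diff_distrib sum_distrib_left sum_subtractf mult.assoc mult.left_commute)
  finally show ?case using Suc by (simp add: mult.commute)
qed

end

theory Submission
  imports Defs
begin

text \<open>
  Put \<open>G(t) = Li(1 - e\<^sup>-\<^sup>t)\<close>. Both sides of the identity compute \<open>n!\<close> times the coefficient
  of \<open>t\<^sup>n\<close> in \<open>G\<close>.

  The generating function of the multi-Stirling numbers is \<open>G(e\<^sup>t - 1)\<close>, because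
  \<open>1 - e\<^bsup>-(e\<^sup>t - 1)\<^esup> = 1 - e\<^bsup>1 - e\<^sup>t\<^esup>\<close>. Passing from the coefficients of \<open>G(e\<^sup>t - 1)\<close> to those
  of \<open>G\<close> is Stirling inversion, \<open>signed_stirling1_inversion\<close>. It is obtained here from
  differential operators: \<open>k!\<close> times the coefficient of \<open>t\<^sup>k\<close> is the value of \<open>D\<^sup>k\<close> at 0, so a
  sum weighted by \<open>S\<^sub>1(n,k)\<close> is the value at 0 of \<open>D (D - 1) \<cdots> (D - n + 1)\<close>, and in the
  variable \<open>u = e\<^sup>t - 1\<close> this operator is \<open>(1 + u)\<^sup>n\<close> times the \<open>n\<close>-th derivative in \<open>u\<close>.

  The generating function of the multi-Lah numbers is \<open>G(t) / (1 - t)\<^sup>r\<close>. Multiplying it back by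
  \<open>(1 - t)\<^sup>r\<close> expresses the coefficients of \<open>G\<close> by a convolution with signed binomial
  coefficients.
\<close>

section \<open>Stirling inversion\<close>

lemma signed_stirling1_eq_0: "n < k \<Longrightarrow> signed_stirling1 n k = 0"
proof -
  assume "n < k"
  moreover have "degree (\<Prod>i<n. [:- int i, 1:]) \<le> n"
    using degree_prod_sum_le[of "{..<n}" "\<lambda>i. [:- int i, 1:]"] by (simp add: o_def)
  ultimately show ?thesis by (simp add: signed_stirling1_def coeff_eq_0)
qed

lemma signed_stirling1_Suc_0: "signed_stirling1 (Suc n) 0 = - int n * signed_stirling1 n 0"
  by (simp add: signed_stirling1_def coeff_mult)

lemma signed_stirling1_Suc_Suc:
  "signed_stirling1 (Suc n) (Suc k) = signed_stirling1 n k - int n * signed_stirling1 n (Suc k)"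
  by (simp add: signed_stirling1_def mult.commute[of _ "[:- int n, 1:]"])

text \<open>
  The operator \<open>D (D - 1) \<cdots> (D - n + 1)\<close> applied to \<open>A(e\<^sup>t - 1)\<close>. One more factor \<open>D - n\<close> removes
  the term that the product rule produces by differentiating \<open>e\<^bsup>nt\<^esup>\<close>, and the chain rule
  contributes a further \<open>e\<^sup>t\<close>.
\<close>
lemma falling_factorial_deriv_compose_exp:
  fixes A :: "'a :: field_char_0 fps"
  shows "(\<Sum>k\<le>n. of_int (signed_stirling1 n k) * fps_nth_deriv k (A oo (fps_exp 1 - 1))) =
         fps_exp (of_nat n) * (fps_nth_deriv n A oo (fps_exp 1 - 1))"
proof (induction n)
  case 0
  show ?case by (simp add: signed_stirling1_def)
next
  case (Suc n)
  define E :: "'a fps" where "E = fps_exp 1 - 1"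
  define d where "d k = fps_nth_deriv k (A oo E)" for k
  define s :: "nat \<Rightarrow> 'a fps" where "s k = of_int (signed_stirling1 n k)" for k
  define B where "B = fps_nth_deriv n A"
  have d_Suc: "d (Suc k) = fps_deriv (d k)" for k
    by (simp only: d_def fps_nth_deriv_commute)
  have s_const: "fps_deriv (s k) = 0" for k
    by (simp add: s_def)
  have IH: "(\<Sum>k\<le>n. s k * d k) = fps_exp (of_nat n) * (B oo E)"
    using Suc by (simp add: s_def d_def B_def E_def)
  have top: "s (Suc n) = 0"
    by (simp add: s_def signed_stirling1_eq_0)
  have "(\<Sum>k\<le>Suc n. of_int (signed_stirling1 (Suc n) k) * d k) =
        (\<Sum>k\<le>n. s k * d (Suc k)) - of_nat n * (\<Sum>k\<le>Suc n. s k * d k)"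
    unfolding sum.atMost_Suc_shift
    by (simp add: s_def signed_stirling1_Suc_0 signed_stirling1_Suc_Suc algebra_simps
        sum_subtractf sum_distrib_left)
  also have "\<dots> = fps_deriv (\<Sum>k\<le>n. s k * d k) - of_nat n * (\<Sum>k\<le>n. s k * d k)"
    by (simp add: top d_Suc s_const fps_deriv_sum)
  also have "\<dots> = fps_exp (of_nat n) * fps_deriv (B oo E)"
    unfolding IH by (simp add: algebra_simps fps_of_nat)
  also have "fps_deriv (B oo E) = fps_exp 1 * (fps_deriv B oo E)"
    by (simp add: fps_compose_deriv E_def)
  also have "fps_exp (of_nat n) * \<dots> = fps_exp (of_nat (Suc n)) * (fps_deriv B oo E)"
    by (simp add: fps_exp_add_mult algebra_simps)
  finally show ?case
    by (simp add: d_def B_def E_def fps_nth_deriv_commute del: fps_nth_deriv.simps(2))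
qed

text \<open>
  The previous identity at \<open>t = 0\<close>, where both \<open>e\<^bsup>nt\<^esup>\<close> and the substitution \<open>u = e\<^sup>t - 1\<close>
  become trivial.
\<close>
lemma signed_stirling1_inversion:
  fixes A :: "'a :: field_char_0 fps"
  shows "(\<Sum>k\<le>n. of_int (signed_stirling1 n k) * (fact k * fps_nth (A oo (fps_exp 1 - 1)) k)) =
         fact n * fps_nth A n"
proof -
  have eval: "fps_nth (of_int c * fps_nth_deriv k f) 0 = of_int c * (fact k * fps_nth f k)"
    for c k and f :: "'a fps"
    by (simp add: fps_deriv_maclauren_0 flip: fps_of_int)
  have "fps_nth (\<Sum>k\<le>n. of_int (signed_stirling1 n k) * fps_nth_deriv k (A oo (fps_exp 1 - 1))) 0 =
        fps_nth (fps_exp (of_nat n) * (fps_nth_deriv n A oo (fps_exp 1 - 1))) 0"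
    by (simp only: falling_factorial_deriv_compose_exp)
  then show ?thesis
    by (simp add: fps_sum_nth eval fps_deriv_maclauren_0)
qed

section \<open>The two generating functions\<close>

lemma exp_compose_one_minus_exp:
  "fps_exp 1 oo (1 - fps_exp 1) = fps_exp (- 1) oo (fps_exp 1 - 1 :: 'a :: field_char_0 fps)"
proof -
  have "(fps_exp 1 oo - fps_X) oo (fps_exp 1 - 1) =
        fps_exp 1 oo (- fps_X oo (fps_exp 1 - 1 :: 'a fps))"
    by (rule fps_compose_assoc[symmetric]) simp_all
  then show ?thesis by (simp add: fps_compose_uminus)
qed

lemma multi_stirling2_eq:
  "multi_stirling2 m ks =
   fact m * fps_nth ((multi_log ks oo (1 - fps_exp (- 1))) oo (fps_exp 1 - 1)) m"
proof -
  have "(multi_log ks oo (1 - fps_exp (- 1))) oo (fps_exp 1 - 1) =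
        multi_log ks oo ((1 - fps_exp (- 1)) oo (fps_exp 1 - 1))"
    by (rule fps_compose_assoc[symmetric]) simp_all
  then show ?thesis
    by (simp add: multi_stirling2_def exp_compose_one_minus_exp fps_compose_sub_distrib)
qed

lemma one_minus_X_power_nth:
  "fps_nth ((1 - fps_X) ^ r) j = (of_nat (r choose j) * (- 1) ^ j :: 'a :: comm_ring_1)"
proof -
  have "(1 - fps_X :: 'a fps) ^ r = (\<Sum>i\<le>r. fps_const (of_nat (r choose i) * (- 1) ^ i) * fps_X ^ i)"
    using binomial_ring[of "- fps_X :: 'a fps" 1 r]
    by (simp add: power_minus[of fps_X] mult.assoc fps_of_nat
        flip: fps_const_mult fps_const_power fps_const_neg)
  then show ?thesis
    by (simp add: fps_sum_nth fps_X_power_iff if_distrib cong: if_cong)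
      (auto simp: binomial_eq_0)
qed

text \<open>
  \<open>(1 - t)\<^sup>r\<close> has constant term 1, so the division in the definition of the multi-Lah numbers
  can be undone by a Cauchy product.
\<close>
lemma multi_lah_convolution:
  "fact n * fps_nth (multi_log ks oo (1 - fps_exp (- 1))) n =
   (\<Sum>m\<le>n. fact n / fact m * multi_lah ks m *
      of_nat (length ks choose (n - m)) * (- 1) ^ (n - m))"
proof -
  define P :: "real fps" where "P = (1 - fps_X) ^ length ks"
  define G where "G = multi_log ks oo (1 - fps_exp (- 1))"
  have "fps_nth P 0 \<noteq> 0"
    by (simp add: P_def fps_nth_power_0)
  then have "G = G / P * P"
    by (simp add: fps_divide_unit mult.assoc inverse_mult_eq_1)
  then have "fps_nth G n = (\<Sum>m\<le>n. fps_nth (G / P) m * fps_nth P (n - m))"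
    by (metis fps_mult_nth atLeast0AtMost)
  then show ?thesis
    by (simp add: G_def P_def multi_lah_def one_minus_X_power_nth sum_distrib_left mult.assoc)
qed

theorem theorem6:
  fixes n r :: nat and ks :: "int list"
  assumes "r \<ge> 1" and "n \<ge> r" and "length ks = r"
  shows "(\<Sum>m = r..n. multi_stirling2 m ks * of_int (signed_stirling1 n m)) =
         (\<Sum>m = r..n. fact n / fact m * multi_lah ks m * of_nat (r choose (n - m)) * (- 1) ^ (n - m))"
proof -
  \<comment> \<open>Both generating functions start at \<open>t\<^sup>r\<close>, so the sums may as well start at 0.\<close>
  have "(\<Sum>m = r..n. multi_stirling2 m ks * of_int (signed_stirling1 n m)) =
        (\<Sum>m\<le>n. of_int (signed_stirling1 n m) * multi_stirling2 m ks)"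
    using assms(3) by (intro sum.mono_neutral_cong_left) (auto simp: multi_stirling2_less)
  also have "\<dots> = fact n * fps_nth (multi_log ks oo (1 - fps_exp (- 1))) n"
    unfolding multi_stirling2_eq by (rule signed_stirling1_inversion)
  also have "\<dots> = (\<Sum>m\<le>n. fact n / fact m * multi_lah ks m *
                    of_nat (r choose (n - m)) * (- 1) ^ (n - m))"
    using assms(3) by (simp add: multi_lah_convolution)
  also have "\<dots> = (\<Sum>m = r..n. fact n / fact m * multi_lah ks m *
                    of_nat (r choose (n - m)) * (- 1) ^ (n - m))"
    using assms(3) by (intro sum.mono_neutral_right) (auto simp: multi_lah_less)
  finally show ?thesis .
qed

end
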